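(* Let $(E,\pi,B)$ be a complex vector bundle with fibres of complex dimension $n$, $g$ a Hermitian bundle metric and $L$ a ($\mathbb{C}$-)linear transport along paths in it. For each path $\gamma:J\to B$ fix bases of the fibres $\pi^{-1}(\gamma(s))$, $s\in J$, and let $F(s;\gamma)$ be a nondegenerate complex matrix function defining the matrix of $L$ by $H(t,s;\gamma)=F^{-1}(t;\gamma)F(s;\gamma)$. Then $L$ and $g$ are consistent (resp. consistent along a given path $\gamma$) if and only if for every (resp. the given) path $\gamma$ there exists a nondegenerate Hermitian matrix $C(\gamma)=C(\gamma)^*$, depending only on $\gamma$ (not on $s$), such that $$\bigl(F^{-1}(s;\gamma)\bigr)^{*}G^{T}(\gamma(s))F^{-1}(s;\gamma)=C(\gamma),\qquad s\in J.$$
   Context: A path in $B$ is a (continuous) map $\gamma:J\to B$ with $J$ an arbitrary real interval. A Hermitian bundle metric $g$ assigns to each $x\in B$ a map $g_x:\pi^{-1}(x)\times\pi^{-1}(x)\to\mathbb{C}$ that is sesquilinear (linear in the first and conjugate-linear in the second argument), nondegenerate, and Hermitian, $g_x(u,v)=\overline{g_x(v,u)}$. Positive definiteness and regularity in $x$ are not assumed. A linear transport along paths $L$ assigns to each path $\gamma:J\to B$ and $s,t\in J$ a $\mathbb{C}$-linear map $L^\gamma_{s\to t}:\pi^{-1}(\gamma(s))\to\pi^{-1}(\gamma(t))$ with $L^\gamma_{t\to r}\circ L^\gamma_{s\to t}=L^\gamma_{s\to r}$ and $L^\gamma_{s\to s}=\mathrm{id}$ for all $r,s,t\in J$. $L$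 and $g$ are consistent along $\gamma$ if $g_{\gamma(s)}(u,v)=g_{\gamma(t)}(L^\gamma_{s\to t}u,L^\gamma_{s\to t}v)$ for all $s,t\in J$, $u,v\in\pi^{-1}(\gamma(s))$; they are (globally) consistent if this holds along every path. In bases $\{e_i(s)\}$: $L^\gamma_{s\to t}e_j(s)=\sum_iH^{i}_{\;j}(t,s;\gamma)e_i(t)$, and $G(\gamma(s))=[g_{\gamma(s)}(e_i(s),e_j(s))]_{ij}$. Every linear transport has a matrix of the form $F^{-1}(t;\gamma)F(s;\gamma)$ with $F(s;\gamma)$ invertible. $T$ is transposition and $*$ is Hermitian conjugation (conjugate transpose) of matrices. *)

theory Defs
  imports "HOL-Analysis.Analysis" "HOL-Algebra.Algebraic_Closure_Type"
begin

text \<open>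
  A vector bundle is given by topologies on the total space \<open>E\<close> and the base \<open>B\<close>, the projection
  \<open>\<pi>\<close>, and the vector space structures \<open>V x\<close> on the fibres, which are HOL-Algebra modules over the
  field of complex numbers (the ring multiplication and unit fields of the record play no role).
  The type argument \<open>'n\<close> carries the rank \<open>CARD('n)\<close>.
\<close>

definition fibre_over :: "'e topology \<Rightarrow> ('e \<Rightarrow> 'b) \<Rightarrow> 'b set \<Rightarrow> 'e set" where
  "fibre_over E \<pi> U = {v \<in> topspace E. \<pi> v \<in> U}"

definition local_trivialisation ::
  "'e topology \<Rightarrow> 'b topology \<Rightarrow> ('e \<Rightarrow> 'b) \<Rightarrow> ('b \<Rightarrow> (complex, 'e) module) \<Rightarrow> 'b set
    \<Rightarrow> ('e \<Rightarrow> 'b \<times> (complex ^ 'n::finite)) \<Rightarrow> bool" where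
  "local_trivialisation E B \<pi> V U \<phi> \<longleftrightarrow>
     openin B U \<and>
     homeomorphic_map (subtopology E (fibre_over E \<pi> U))
       (prod_topology (subtopology B U) euclidean) \<phi> \<and>
     (\<forall>v \<in> fibre_over E \<pi> U. fst (\<phi> v) = \<pi> v) \<and>
     (\<forall>x \<in> U. \<forall>u \<in> carrier (V x). \<forall>v \<in> carrier (V x). \<forall>a.
        snd (\<phi> (u \<oplus>\<^bsub>V x\<^esub> v)) = snd (\<phi> u) + snd (\<phi> v) \<and>
        snd (\<phi> (a \<odot>\<^bsub>V x\<^esub> v)) = a *s snd (\<phi> v))"

definition complex_vector_bundle ::
  "'e topology \<Rightarrow> 'b topology \<Rightarrow> ('e \<Rightarrow> 'b) \<Rightarrow> ('b \<Rightarrow> (complex, 'e) module)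
    \<Rightarrow> 'n::finite itself \<Rightarrow> bool" where
  "complex_vector_bundle E B \<pi> V n \<longleftrightarrow>
     continuous_map E B \<pi> \<and>
     (\<forall>x \<in> topspace B. carrier (V x) = fibre_over E \<pi> {x} \<and>
        Module.module ring_of_type_algebra (V x)) \<and>
     (\<forall>x \<in> topspace B. \<exists>U (\<phi> :: 'e \<Rightarrow> 'b \<times> (complex ^ 'n)).
        x \<in> U \<and> local_trivialisation E B \<pi> V U \<phi>)"

definition fibre_linear ::
  "(complex, 'e) module \<Rightarrow> (complex, 'e) module \<Rightarrow> ('e \<Rightarrow> 'e) \<Rightarrow> bool" where
  "fibre_linear V W f \<longleftrightarrow>
     f \<in> carrier V \<rightarrow> carrier W \<and>
     (\<forall>u \<in> carrier V. \<forall>v \<in> carrier V. f (u \<oplus>\<^bsub>V\<^esub> v) = f u \<oplus>\<^bsub>W\<^esub> f v) \<and>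
     (\<forall>a. \<forall>v \<in> carrier V. f (a \<odot>\<^bsub>V\<^esub> v) = a \<odot>\<^bsub>W\<^esub> f v)"

definition lincomb ::
  "(complex, 'e) module \<Rightarrow> ('n \<Rightarrow> 'e) \<Rightarrow> complex ^ 'n::finite \<Rightarrow> 'e" where
  "lincomb V e c = (\<Oplus>\<^bsub>V\<^esub>i\<in>UNIV. c $ i \<odot>\<^bsub>V\<^esub> e i)"

definition fibre_basis :: "(complex, 'e) module \<Rightarrow> ('n::finite \<Rightarrow> 'e) \<Rightarrow> bool" where
  "fibre_basis V e \<longleftrightarrow>
     range e \<subseteq> carrier V \<and>
     (\<forall>c. lincomb V e c = \<zero>\<^bsub>V\<^esub> \<longrightarrow> c = 0) \<and>
     (\<forall>v \<in> carrier V. \<exists>c. v = lincomb V e c)"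

definition hermitian_bundle_metric ::
  "'b topology \<Rightarrow> ('b \<Rightarrow> (complex, 'e) module) \<Rightarrow> ('b \<Rightarrow> 'e \<Rightarrow> 'e \<Rightarrow> complex) \<Rightarrow> bool" where
  "hermitian_bundle_metric B V g \<longleftrightarrow>
     (\<forall>x \<in> topspace B.
        (\<forall>u \<in> carrier (V x). \<forall>v \<in> carrier (V x). \<forall>w \<in> carrier (V x).
           g x (u \<oplus>\<^bsub>V x\<^esub> v) w = g x u w + g x v w \<and>
           g x w (u \<oplus>\<^bsub>V x\<^esub> v) = g x w u + g x w v) \<and>
        (\<forall>a. \<forall>u \<in> carrier (V x). \<forall>v \<in> carrier (V x).
           g x (a \<odot>\<^bsub>V x\<^esub> u) v = a * g x u v \<and>
           g x u (a \<odot>\<^bsub>V x\<^esub> v) = cnj a * g x u v) \<and>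
        (\<forall>u \<in> carrier (V x). (\<forall>v \<in> carrier (V x). g x u v = 0) \<longrightarrow> u = \<zero>\<^bsub>V x\<^esub>) \<and>
        (\<forall>u \<in> carrier (V x). \<forall>v \<in> carrier (V x). g x u v = cnj (g x v u)))"

text \<open>
  A path is a pair of an interval and a map on it. Extensionality makes the HOL function
  carry no information beyond its values on \<open>J\<close>, so that data depending on a path depend only on
  the map \<open>J \<rightarrow> B\<close>.
\<close>

definition is_path :: "'b topology \<Rightarrow> real set \<Rightarrow> (real \<Rightarrow> 'b) \<Rightarrow> bool" where
  "is_path B J \<gamma> \<longleftrightarrow>
     is_interval J \<and> continuous_map (top_of_set J) B \<gamma> \<and> \<gamma> \<in> extensional J"

text \<open>\<open>L J \<gamma> s t\<close> is the transport along \<open>\<gamma> : J \<rightarrow> B\<close> from \<open>s\<close> to \<open>t\<close>.\<close>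

type_synonym ('b, 'e) transport = "real set \<Rightarrow> (real \<Rightarrow> 'b) \<Rightarrow> real \<Rightarrow> real \<Rightarrow> 'e \<Rightarrow> 'e"

definition linear_transport ::
  "'b topology \<Rightarrow> ('b \<Rightarrow> (complex, 'e) module) \<Rightarrow> ('b, 'e) transport \<Rightarrow> bool" where
  "linear_transport B V L \<longleftrightarrow>
     (\<forall>J \<gamma>. is_path B J \<gamma> \<longrightarrow>
        (\<forall>s \<in> J. \<forall>t \<in> J. fibre_linear (V (\<gamma> s)) (V (\<gamma> t)) (L J \<gamma> s t)) \<and>
        (\<forall>s \<in> J. \<forall>t \<in> J. \<forall>r \<in> J. \<forall>u \<in> carrier (V (\<gamma> s)).
           L J \<gamma> t r (L J \<gamma> s t u) = L J \<gamma> s r u) \<and>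
        (\<forall>s \<in> J. \<forall>u \<in> carrier (V (\<gamma> s)). L J \<gamma> s s u = u))"

definition consistent_along ::
  "('b \<Rightarrow> (complex, 'e) module) \<Rightarrow> ('b, 'e) transport \<Rightarrow> ('b \<Rightarrow> 'e \<Rightarrow> 'e \<Rightarrow> complex)
    \<Rightarrow> real set \<Rightarrow> (real \<Rightarrow> 'b) \<Rightarrow> bool" where
  "consistent_along V L g J \<gamma> \<longleftrightarrow>
     (\<forall>s \<in> J. \<forall>t \<in> J. \<forall>u \<in> carrier (V (\<gamma> s)). \<forall>v \<in> carrier (V (\<gamma> s)).
        g (\<gamma> s) u v = g (\<gamma> t) (L J \<gamma> s t u) (L J \<gamma> s t v))"

definition consistent ::
  "'b topology \<Rightarrow> ('b \<Rightarrow> (complex, 'e) module) \<Rightarrow> ('b, 'e) transport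
    \<Rightarrow> ('b \<Rightarrow> 'e \<Rightarrow> 'e \<Rightarrow> complex) \<Rightarrow> bool" where
  "consistent B V L g \<longleftrightarrow> (\<forall>J \<gamma>. is_path B J \<gamma> \<longrightarrow> consistent_along V L g J \<gamma>)"

text \<open>
  The matrix \<open>H\<close> of a linear map \<open>f\<close> into \<open>W\<close> in the bases \<open>d\<close> of its domain and \<open>e\<close> of \<open>W\<close>: column \<open>j\<close> holds the
  components of \<open>f (d j)\<close>.
\<close>

definition is_matrix_in_bases ::
  "(complex, 'e) module \<Rightarrow> ('n \<Rightarrow> 'e) \<Rightarrow> ('n::finite \<Rightarrow> 'e) \<Rightarrow> ('e \<Rightarrow> 'e)
    \<Rightarrow> complex ^ 'n ^ 'n \<Rightarrow> bool" where
  "is_matrix_in_bases W d e f H \<longleftrightarrow> (\<forall>j. f (d j) = lincomb W e (column j H))"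

definition gram_matrix ::
  "('e \<Rightarrow> 'e \<Rightarrow> complex) \<Rightarrow> ('n::finite \<Rightarrow> 'e) \<Rightarrow> complex ^ 'n ^ 'n" where
  "gram_matrix h e = (\<chi> i j. h (e i) (e j))"

definition conj_transpose :: "complex ^ 'n ^ 'm \<Rightarrow> complex ^ 'm ^ 'n" where
  "conj_transpose A = transpose (map_matrix cnj A)"

end

theory Submission
  imports Defs
begin

text \<open>
  Consistency of \<open>g\<close> and \<open>L\<close> between the parameters \<open>s\<close> and \<open>t\<close> says that \<open>g\<close> at \<open>\<gamma> s\<close> is the pullback along
  \<open>L\<close> of \<open>g\<close> at \<open>\<gamma> t\<close>. Sesquilinear forms are determined by their Gram matrices, so this is the equation
  \<open>G\<^sup>T(s) = H\<^sup>* G\<^sup>T(t) H\<close> with \<open>H = F\<^sup>-\<^sup>1(t) F(s)\<close>. Moving \<open>F(s)\<close> to the left side turns it into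
  \<open>K(s) = K(t)\<close>, where \<open>K(s) = (F\<^sup>-\<^sup>1(s))\<^sup>* G\<^sup>T(s) F\<^sup>-\<^sup>1(s)\<close>. Each \<open>K(s)\<close> is Hermitian and invertible because
  \<open>g\<close> is Hermitian and nondegenerate; if \<open>J\<close> is empty, any such matrix serves as \<open>C\<close>.
\<close>

section \<open>Hermitian conjugates, inverses and congruence of complex matrices\<close>

lemma conj_transpose_nth [simp]: "conj_transpose A $ i $ j = cnj (A $ j $ i)"
  by (simp add: conj_transpose_def transpose_def)

lemma conj_transpose_conj_transpose [simp]: "conj_transpose (conj_transpose A) = A"
  by (simp add: vec_eq_iff)

lemma conj_transpose_mat_1 [simp]: "conj_transpose (mat 1) = mat 1"
  by (simp add: vec_eq_iff mat_def)

lemma conj_transpose_mult: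
  "conj_transpose (A ** B) = conj_transpose B ** conj_transpose A"
  by (simp add: vec_eq_iff matrix_matrix_mult_def mult.commute)

lemma invertible_conj_transpose:
  fixes A :: "complex ^ 'n ^ 'n"
  assumes "invertible A"
  shows "invertible (conj_transpose A)"
  using assms unfolding invertible_def
  by (metis conj_transpose_mult conj_transpose_mat_1)

lemma matrix_inv_mult_left: "invertible A \<Longrightarrow> matrix_inv A ** A = mat 1"
  and matrix_inv_mult_right: "invertible A \<Longrightarrow> A ** matrix_inv A = mat 1"
  using someI_ex[of "\<lambda>B. A ** B = mat 1 \<and> B ** A = mat 1"]
  by (auto simp: invertible_def matrix_inv_def)

lemma invertible_matrix_inv: "invertible A \<Longrightarrow> invertible (matrix_inv A)"
  using matrix_inv_mult_left matrix_inv_mult_right by (auto simp: invertible_def)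

text \<open>For invertible \<open>P\<close>, the map \<open>X \<mapsto> P\<^sup>* X P\<close> is a
  bijection, with inverse given by congruence with \<open>matrix_inv P\<close>. Applying it
  separates the variables: each side of the second equation involves only one of \<open>P\<close>
  and \<open>Q\<close>.\<close>

lemma congruence_eq_iff:
  fixes P Q M N :: "complex ^ 'n ^ 'n"
  assumes P: "invertible P"
  shows "M = conj_transpose (matrix_inv Q ** P) ** N ** (matrix_inv Q ** P) \<longleftrightarrow>
    conj_transpose (matrix_inv P) ** M ** matrix_inv P =
    conj_transpose (matrix_inv Q) ** N ** matrix_inv Q" (is "M = ?z \<longleftrightarrow> ?l = ?r")
proof -
  have P': "conj_transpose P ** conj_transpose (matrix_inv P) = mat 1"
    "conj_transpose (matrix_inv P) ** conj_transpose P = mat 1"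
    using P by (simp_all add: conj_transpose_mult[symmetric]
        matrix_inv_mult_left matrix_inv_mult_right)
  have Z: "?z = conj_transpose P ** ?r ** P"
    by (simp add: conj_transpose_mult matrix_mul_assoc)
  \<comment> \<open>Facts \<open>1\<close> and \<open>2\<close> say that the two congruences undo
    each other, at \<open>M\<close> and at \<open>?r\<close> respectively. Each gives one direction
    of the equivalence.\<close>
  have "conj_transpose P ** ?l ** P =
      (conj_transpose P ** conj_transpose (matrix_inv P)) ** M ** (matrix_inv P ** P)"
    by (simp only: matrix_mul_assoc)
  then have 1: "conj_transpose P ** ?l ** P = M"
    using P by (simp add: P' matrix_inv_mult_left)
  have "conj_transpose (matrix_inv P) ** (conj_transpose P ** ?r ** P) ** matrix_inv P =
      (conj_transpose (matrix_inv P) ** conj_transpose P) ** ?r ** (P ** matrix_inv P)"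
    by (simp only: matrix_mul_assoc)
  then have 2: "conj_transpose (matrix_inv P) ** (conj_transpose P ** ?r ** P) ** matrix_inv P = ?r"
    using P by (simp add: P' matrix_inv_mult_right)
  show ?thesis
    unfolding Z using 1 2 by metis
qed

section \<open>Sesquilinear forms on modules and their Gram matrices\<close>

definition sesquilinear_on ::
  "(complex, 'e) module \<Rightarrow> ('e \<Rightarrow> 'e \<Rightarrow> complex) \<Rightarrow> bool" where
  "sesquilinear_on V h \<longleftrightarrow>
     (\<forall>u \<in> carrier V. \<forall>v \<in> carrier V. \<forall>w \<in> carrier V.
        h (u \<oplus>\<^bsub>V\<^esub> v) w = h u w + h v w \<and> h w (u \<oplus>\<^bsub>V\<^esub> v) = h w u + h w v) \<and>
     (\<forall>a. \<forall>u \<in> carrier V. \<forall>v \<in> carrier V.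
        h (a \<odot>\<^bsub>V\<^esub> u) v = a * h u v \<and> h u (a \<odot>\<^bsub>V\<^esub> v) = cnj a * h u v)"

text \<open>Applied to a transport map, this carries the metric at the end point to the initial
  fibre, where the two forms can be compared. Only sesquilinearity survives in general: a map with a
  kernel destroys nondegeneracy.\<close>

lemma sesquilinear_on_pullback:
  assumes "sesquilinear_on W h" and "fibre_linear V W f"
  shows "sesquilinear_on V (\<lambda>u v. h (f u) (f v))"
  using assms unfolding sesquilinear_on_def fibre_linear_def by (simp add: Pi_iff)

lemma sesquilinear_on_hermitian_bundle_metric:
  assumes "hermitian_bundle_metric B V g" and "x \<in> topspace B"
  shows "sesquilinear_on (V x) (g x)"
  using assms unfolding sesquilinear_on_def hermitian_bundle_metric_def by blast

lemma smult_closed_UNIV: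
  fixes V :: "(complex, 'e) module"
  assumes "Module.module ring_of_type_algebra V" and "v \<in> carrier V"
  shows "a \<odot>\<^bsub>V\<^esub> v \<in> carrier V"
  using module.smult_closed[OF assms(1) _ assms(2)] by (simp add: ring_of_type_algebra_def)

lemma lincomb_closed:
  assumes "Module.module ring_of_type_algebra V" and "range e \<subseteq> carrier V"
  shows "lincomb V e c \<in> carrier V"
proof -
  interpret Module.module ring_of_type_algebra V by fact
  show ?thesis
    unfolding lincomb_def using assms by (intro M.finsum_closed) (auto intro: smult_closed_UNIV)
qed

text \<open>Only additivity of \<open>f\<close> is assumed, so that both slots of a form are
  covered, the linear and the conjugate-linear one.\<close>

lemma additive_finsum:
  fixes f :: "'e \<Rightarrow> complex"
  assumes "abelian_monoid V"
    and add: "\<And>u v. u \<in> carrier V \<Longrightarrow> v \<in> carrier V \<Longrightarrow> f (u \<oplus>\<^bsub>V\<^esub> v) = f u + f v"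
    and "finite I" and "w \<in> I \<rightarrow> carrier V"
  shows "f (\<Oplus>\<^bsub>V\<^esub>i\<in>I. w i) = (\<Sum>i\<in>I. f (w i))"
proof -
  interpret abelian_monoid V by fact
  have "f \<zero>\<^bsub>V\<^esub> + f \<zero>\<^bsub>V\<^esub> = f \<zero>\<^bsub>V\<^esub>"
    using add[of "\<zero>\<^bsub>V\<^esub>" "\<zero>\<^bsub>V\<^esub>"] by simp
  then have zero: "f \<zero>\<^bsub>V\<^esub> = 0"
    by simp
  show ?thesis
    using assms(3,4)
  proof (induction I rule: finite_induct)
    case empty
    then show ?case by (simp add: zero)
  next
    case (insert i I)
    then have "w \<in> I \<rightarrow> carrier V" and "w i \<in> carrier V"
      by auto
    with insert show ?case
      by (simp add: finsum_insert add finsum_closed)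
  qed
qed

lemma sesquilinear_on_lincomb:
  assumes V: "Module.module ring_of_type_algebra V" and h: "sesquilinear_on V h"
    and e: "range e \<subseteq> carrier V"
  shows "h (lincomb V e c) (lincomb V e d) =
    (\<Sum>i\<in>UNIV. \<Sum>j\<in>UNIV. c $ i * cnj (d $ j) * h (e i) (e j))"
proof -
  interpret Module.module ring_of_type_algebra V by fact
  have am: "abelian_monoid V" ..
  have e': "e i \<in> carrier V" for i
    using e by auto
  have left: "h (lincomb V e c) w = (\<Sum>i\<in>UNIV. c $ i * h (e i) w)" if "w \<in> carrier V" for w
    unfolding lincomb_def
    using h that e' smult_closed_UNIV[OF V]
    by (subst additive_finsum[OF am, of "\<lambda>u. h u w"]) (auto simp: sesquilinear_on_def)
  have right: "h w (lincomb V e d) = (\<Sum>i\<in>UNIV. cnj (d $ i) * h w (e i))" if "w \<in> carrier V" for w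
    unfolding lincomb_def
    using h that e' smult_closed_UNIV[OF V]
    by (subst additive_finsum[OF am, of "\<lambda>u. h w u"]) (auto simp: sesquilinear_on_def)
  show ?thesis
    by (subst left[OF lincomb_closed[OF V e]])
      (simp add: right e' sum_distrib_left mult.assoc)
qed

text \<open>Expanding both arguments in the basis expresses every value of a form through its values
  on pairs of basis vectors.\<close>

lemma sesquilinear_on_eq_iff_gram_matrix:
  assumes V: "Module.module ring_of_type_algebra V" and e: "fibre_basis V e"
    and h: "sesquilinear_on V h" and k: "sesquilinear_on V k"
  shows "(\<forall>u \<in> carrier V. \<forall>v \<in> carrier V. h u v = k u v) \<longleftrightarrow> gram_matrix h e = gram_matrix k e"
proof
  have e': "range e \<subseteq> carrier V"
    using e by (simp add: fibre_basis_def)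
  show "gram_matrix h e = gram_matrix k e" if "\<forall>u \<in> carrier V. \<forall>v \<in> carrier V. h u v = k u v"
    using that e' by (simp add: gram_matrix_def vec_eq_iff image_subset_iff)
  assume "gram_matrix h e = gram_matrix k e"
  then have "h (e i) (e j) = k (e i) (e j)" for i j
    by (simp add: gram_matrix_def vec_eq_iff)
  then have "h (lincomb V e c) (lincomb V e d) = k (lincomb V e c) (lincomb V e d)" for c d
    by (simp add: sesquilinear_on_lincomb[OF V _ e'] h k)
  then show "\<forall>u \<in> carrier V. \<forall>v \<in> carrier V. h u v = k u v"
    using e unfolding fibre_basis_def by metis
qed

text \<open>With linearity in the first slot, the form at coefficient columns \<open>c\<close>,
  \<open>d\<close> is \<open>d\<^sup>* G\<^sup>T c\<close>. Hence it is the transpose of the Gram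
  matrix that transforms by congruence when \<open>H\<close> acts on columns.\<close>

lemma transpose_gram_matrix_pullback:
  assumes W: "Module.module ring_of_type_algebra W" and e: "range e \<subseteq> carrier W"
    and h: "sesquilinear_on W h" and H: "is_matrix_in_bases W d e f H"
  shows "transpose (gram_matrix (\<lambda>u v. h (f u) (f v)) d) =
    conj_transpose H ** transpose (gram_matrix h e) ** H"
proof -
  have "h (f (d i)) (f (d j)) =
      (\<Sum>k\<in>UNIV. (\<Sum>l\<in>UNIV. cnj (H $ l $ j) * h (e k) (e l)) * H $ k $ i)" for i j
    using H
    by (simp add: is_matrix_in_bases_def sesquilinear_on_lincomb[OF W h e] column_def
        sum_distrib_left sum_distrib_right mult_ac)
  then show ?thesis
    by (simp add: vec_eq_iff transpose_def gram_matrix_def matrix_matrix_mult_def)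
qed

text \<open>A kernel vector \<open>c\<close> yields a vector \<open>lincomb V e c\<close> that pairs
  to zero with the whole fibre. Nondegeneracy makes it zero and independence of the basis gives
  \<open>c = 0\<close>; a square matrix with trivial kernel is invertible.\<close>

lemma invertible_transpose_gram_matrix:
  assumes V: "Module.module ring_of_type_algebra V" and e: "fibre_basis V e"
    and h: "sesquilinear_on V h"
    and nondeg: "\<And>u. u \<in> carrier V \<Longrightarrow> \<forall>v \<in> carrier V. h u v = 0 \<Longrightarrow> u = \<zero>\<^bsub>V\<^esub>"
  shows "invertible (transpose (gram_matrix h e))"
proof -
  have e': "range e \<subseteq> carrier V"
    using e by (simp add: fibre_basis_def)
  have "c = 0" if c: "transpose (gram_matrix h e) *v c = 0" for c
  proof -
    have c': "(\<Sum>i\<in>UNIV. c $ i * h (e i) (e j)) = 0" for j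
      using c by (simp add: vec_eq_iff matrix_vector_mult_def transpose_def gram_matrix_def
          mult.commute)
    \<comment> \<open>The inner sum is the \<open>j\<close>-th entry of the transposed Gram matrix
      applied to \<open>c\<close>, which vanishes by \<open>c'\<close>.\<close>
    have "h (lincomb V e c) (lincomb V e d) =
        (\<Sum>j\<in>UNIV. cnj (d $ j) * (\<Sum>i\<in>UNIV. c $ i * h (e i) (e j)))" for d
      unfolding sesquilinear_on_lincomb[OF V h e'] sum_distrib_left
      by (subst sum.swap) (simp add: mult_ac)
    then have "h (lincomb V e c) (lincomb V e d) = 0" for d
      by (simp add: c')
    then have "\<forall>v \<in> carrier V. h (lincomb V e c) v = 0"
      using e unfolding fibre_basis_def by metis
    then have "lincomb V e c = \<zero>\<^bsub>V\<^esub>"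
      by (intro nondeg lincomb_closed V e')
    then show "c = 0"
      using e by (simp add: fibre_basis_def)
  qed
  then show ?thesis
    by (simp add: invertible_left_inverse matrix_left_invertible_ker)
qed

lemma conj_transpose_congruence:
  assumes "conj_transpose M = M"
  shows "conj_transpose (conj_transpose A ** M ** A) = conj_transpose A ** M ** A"
  by (simp add: conj_transpose_mult assms matrix_mul_assoc)

lemma invertible_congruence:
  fixes A M :: "complex ^ 'n ^ 'n"
  assumes "invertible A" and "invertible M"
  shows "invertible (conj_transpose A ** M ** A)"
  by (intro invertible_mult invertible_conj_transpose assms)

lemma is_path_in_topspace: "is_path B J \<gamma> \<Longrightarrow> s \<in> J \<Longrightarrow> \<gamma> s \<in> topspace B"
  by (auto simp: is_path_def continuous_map_def)

section \<open>Consistency along a path as constancy of a matrix function\<close>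

theorem proposition4p2:
  fixes E :: "'e topology" and B :: "'b topology" and \<pi> :: "'e \<Rightarrow> 'b"
    and V :: "'b \<Rightarrow> (complex, 'e) module"
    and g :: "'b \<Rightarrow> 'e \<Rightarrow> 'e \<Rightarrow> complex"
    and L :: "('b, 'e) transport"
    and e :: "real set \<Rightarrow> (real \<Rightarrow> 'b) \<Rightarrow> real \<Rightarrow> 'n::finite \<Rightarrow> 'e"
    and F :: "real set \<Rightarrow> (real \<Rightarrow> 'b) \<Rightarrow> real \<Rightarrow> complex ^ 'n ^ 'n"
  assumes "complex_vector_bundle E B \<pi> V TYPE('n)"
    and "hermitian_bundle_metric B V g"
    and "linear_transport B V L"
    and "\<And>J \<gamma> s. is_path B J \<gamma> \<Longrightarrow> s \<in> J \<Longrightarrow> fibre_basis (V (\<gamma> s)) (e J \<gamma> s)"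
    and "\<And>J \<gamma> s. is_path B J \<gamma> \<Longrightarrow> s \<in> J \<Longrightarrow> invertible (F J \<gamma> s)"
    and "\<And>J \<gamma> s t. is_path B J \<gamma> \<Longrightarrow> s \<in> J \<Longrightarrow> t \<in> J \<Longrightarrow>
           is_matrix_in_bases (V (\<gamma> t)) (e J \<gamma> s) (e J \<gamma> t) (L J \<gamma> s t)
             (matrix_inv (F J \<gamma> t) ** F J \<gamma> s)"
  shows "(consistent B V L g \<longleftrightarrow>
           (\<forall>J \<gamma>. is_path B J \<gamma> \<longrightarrow>
             (\<exists>C. invertible C \<and> C = conj_transpose C \<and>
               (\<forall>s \<in> J. conj_transpose (matrix_inv (F J \<gamma> s)) **
                  transpose (gram_matrix (g (\<gamma> s)) (e J \<gamma> s)) ** matrix_inv (F J \<gamma> s) = C)))) \<and>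
         (\<forall>J \<gamma>. is_path B J \<gamma> \<longrightarrow>
           (consistent_along V L g J \<gamma> \<longleftrightarrow>
             (\<exists>C. invertible C \<and> C = conj_transpose C \<and>
               (\<forall>s \<in> J. conj_transpose (matrix_inv (F J \<gamma> s)) **
                  transpose (gram_matrix (g (\<gamma> s)) (e J \<gamma> s)) ** matrix_inv (F J \<gamma> s) = C))))"
proof -
  define K where "K J \<gamma> s = conj_transpose (matrix_inv (F J \<gamma> s)) **
    transpose (gram_matrix (g (\<gamma> s)) (e J \<gamma> s)) ** matrix_inv (F J \<gamma> s)" for J \<gamma> s
  have along: "consistent_along V L g J \<gamma> \<longleftrightarrow>
      (\<exists>C. invertible C \<and> C = conj_transpose C \<and> (\<forall>s \<in> J. K J \<gamma> s = C))"
    if path: "is_path B J \<gamma>" for J \<gamma>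
  proof -
    have V: "Module.module ring_of_type_algebra (V (\<gamma> s))" if "s \<in> J" for s
      using assms(1) is_path_in_topspace[OF path that] by (simp add: complex_vector_bundle_def)
    have sesq: "sesquilinear_on (V (\<gamma> s)) (g (\<gamma> s))" if "s \<in> J" for s
      using assms(2) is_path_in_topspace[OF path that]
      by (rule sesquilinear_on_hermitian_bundle_metric)
    have range: "range (e J \<gamma> s) \<subseteq> carrier (V (\<gamma> s))" if "s \<in> J" for s
      using assms(4)[OF path that] by (simp add: fibre_basis_def)
    have pair: "(\<forall>u \<in> carrier (V (\<gamma> s)). \<forall>v \<in> carrier (V (\<gamma> s)).
        g (\<gamma> s) u v = g (\<gamma> t) (L J \<gamma> s t u) (L J \<gamma> s t v)) \<longleftrightarrow> K J \<gamma> s = K J \<gamma> t"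
      if s: "s \<in> J" and t: "t \<in> J" for s t
    proof -
      have L: "fibre_linear (V (\<gamma> s)) (V (\<gamma> t)) (L J \<gamma> s t)"
        using assms(3) path s t by (simp add: linear_transport_def)
      show ?thesis
        \<comment> \<open>The equation of \<open>K\<close> values is rewritten backwards to the
          congruence by \<open>H\<close>, then to an equation of transposed Gram matrices; the left
          side becomes the same equation without transposes.\<close>
        unfolding K_def
          congruence_eq_iff[OF assms(5)[OF path s], of _ "F J \<gamma> t", symmetric]
          sesquilinear_on_eq_iff_gram_matrix[OF V[OF s] assms(4)[OF path s] sesq[OF s]
            sesquilinear_on_pullback[OF sesq[OF t] L]]
          transpose_gram_matrix_pullback[OF V[OF t] range[OF t] sesq[OF t]
            assms(6)[OF path s t], symmetric]
        by (metis transpose_transpose)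
    qed
    have herm: "conj_transpose (K J \<gamma> s) = K J \<gamma> s" if s: "s \<in> J" for s
    proof -
      have "cnj (g (\<gamma> s) (e J \<gamma> s i) (e J \<gamma> s j)) = g (\<gamma> s) (e J \<gamma> s j) (e J \<gamma> s i)" for i j
      proof -
        have "e J \<gamma> s i \<in> carrier (V (\<gamma> s))" "e J \<gamma> s j \<in> carrier (V (\<gamma> s))"
          using range[OF s] by auto
        then show ?thesis
          using assms(2) is_path_in_topspace[OF path s]
          unfolding hermitian_bundle_metric_def by metis
      qed
      then have "conj_transpose (transpose (gram_matrix (g (\<gamma> s)) (e J \<gamma> s))) =
          transpose (gram_matrix (g (\<gamma> s)) (e J \<gamma> s))"
        by (simp add: vec_eq_iff transpose_def gram_matrix_def)
      then show ?thesis
        unfolding K_def by (rule conj_transpose_congruence)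
    qed
    have inv: "invertible (K J \<gamma> s)" if s: "s \<in> J" for s
    proof -
      have "invertible (transpose (gram_matrix (g (\<gamma> s)) (e J \<gamma> s)))"
        using assms(2) is_path_in_topspace[OF path s]
        by (intro invertible_transpose_gram_matrix[OF V[OF s] assms(4)[OF path s] sesq[OF s]])
          (auto simp only: hermitian_bundle_metric_def)
      then show ?thesis
        unfolding K_def
        by (intro invertible_congruence invertible_matrix_inv assms(5)[OF path s])
    qed
    have "consistent_along V L g J \<gamma> \<longleftrightarrow> (\<forall>s \<in> J. \<forall>t \<in> J. K J \<gamma> s = K J \<gamma> t)"
      unfolding consistent_along_def using pair by simp
    also have "\<dots> \<longleftrightarrow> (\<exists>C. invertible C \<and> C = conj_transpose C \<and> (\<forall>s \<in> J. K J \<gamma> s = C))"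
    proof (cases "J = {}")
      case True
      have "invertible (mat 1 :: complex ^ 'n ^ 'n)"
        by (auto simp: invertible_def)
      with True show ?thesis
        by (auto intro: exI[of _ "mat 1"])
    next
      \<comment> \<open>The value of \<open>K\<close> at any point of \<open>J\<close> is the
        required \<open>C\<close>.\<close>
      case False
      then show ?thesis
        using herm inv by (metis all_not_in_conv)
    qed
    finally show ?thesis .
  qed
  show ?thesis
    unfolding K_def[symmetric] consistent_def using along by blast
qed

end
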